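(* Let $\Sigma$ be a finite alphabet with at least two letters. Let $n>0$ be an integer, let $R\subseteq\Sigma^*$ be a language accepted by a DFA $M$ over $\Sigma$ with $n$ states, and let $L\subseteq\Sigma^*$ be an arbitrary language. Then there exists a DFA with at most $2^n$ states that accepts $(L\backslash R)^*$.
   Context: A DFA is a tuple $(Q,\Sigma,\delta,s,F)$ with $Q$ a finite nonempty set of states, $\Sigma$ a finite nonempty input alphabet, $\delta:Q\times\Sigma\to Q$ the transition function, $s\in Q$ the initial state and $F\subseteq Q$ the set of final states. All DFAs are complete, i.e. $\delta$ is a total function. For languages $L,R\subseteq\Sigma^*$, the left quotient of $R$ by $L$ is $L\backslash R=\{y\mid xy\in R\text{ for some }x\in L\}$. For a language $K$, $K^*$ denotes its Kleene star. *)

theory Defs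
  imports Main
begin

record ('q, 'a) dfa =
  states :: "'q set"
  alphabet :: "'a set"
  trans :: "'q \<Rightarrow> 'a \<Rightarrow> 'q"
  start :: 'q
  finals :: "'q set"

(* Completeness: trans maps states and letters of the DFA back into its set of states;
   the values of trans outside these two sets are irrelevant. *)
definition wf_dfa :: "('q, 'a) dfa \<Rightarrow> bool" where
  "wf_dfa M \<longleftrightarrow>
     finite (states M) \<and> states M \<noteq> {} \<and>
     finite (alphabet M) \<and> alphabet M \<noteq> {} \<and>
     (\<forall>q\<in>states M. \<forall>a\<in>alphabet M. trans M q a \<in> states M) \<and>
     start M \<in> states M \<and>
     finals M \<subseteq> states M"

definition language :: "('q, 'a) dfa \<Rightarrow> 'a list set" where
  "language M = {w \<in> lists (alphabet M). foldl (trans M) (start M) w \<in> finals M}"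

definition left_quotient :: "'a list set \<Rightarrow> 'a list set \<Rightarrow> 'a list set" where
  "left_quotient L R = {y. \<exists>x\<in>L. x @ y \<in> R}"

definition kleene_star :: "'a list set \<Rightarrow> 'a list set" where
  "kleene_star K = {concat ws | ws. ws \<in> lists K}"

end

(* The quotient L\R is accepted from the set I of all states reached on words of L, so it is an
   NFA with several initial states. In the subset construction for its star, I is added to every
   set that meets F; hence every set S reached satisfies: if S meets F, then I is contained in S.
   If I meets F, then I itself serves as the (accepting) initial state. Otherwise a fresh initial
   state is needed, but the set {f} with f in F is not reached, so the total is still at
   most 2^n. If I or F is empty, the star is {[]} and two states suffice. *)
theory Submission
  imports Defs
begin

section \<open>Kleene star of a language\<close>

lemma Nil_in_kleene_star: "[] \<in> kleene_star K"
  unfolding kleene_star_def by (force intro: exI[of _ "[]"])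

lemma kleene_star_append: "u \<in> kleene_star K \<Longrightarrow> v \<in> K \<Longrightarrow> u @ v \<in> kleene_star K"
  unfolding kleene_star_def by (force intro: exI[of _ "_ @ [v]"])

lemma kleene_star_empty: "kleene_star {} = {[]}"
  by (auto simp: kleene_star_def)

lemma kleene_star_subset_lists: "K \<subseteq> lists A \<Longrightarrow> kleene_star K \<subseteq> lists A"
  unfolding kleene_star_def by fastforce

lemma kleene_star_snocE:
  assumes "w @ [a] \<in> kleene_star K"
  obtains u v where "w = u @ v" "u \<in> kleene_star K" "v @ [a] \<in> K"
proof -
  obtain ws where "ws \<in> lists K" "w @ [a] = concat ws"
    using assms unfolding kleene_star_def by blast
  then show thesis
  proof (induction ws rule: rev_induct)
    case (snoc x xs)
    show ?case
    proof (cases x rule: rev_cases)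
      case Nil
      then show ?thesis using snoc by auto
    next
      case (snoc y b)
      then show ?thesis
        using snoc.prems by (intro that[of "concat xs" y]) (auto simp: kleene_star_def)
    qed
  qed simp
qed

section \<open>Runs, renaming of states, and a small automaton\<close>

lemma foldl_trans_in_states:
  assumes "wf_dfa M" "q \<in> states M" "w \<in> lists (alphabet M)"
  shows "foldl (trans M) q w \<in> states M"
  using assms(2,3)
proof (induction w arbitrary: q)
  case (Cons a w)
  then show ?case using assms(1) by (simp add: wf_dfa_def)
qed simp

text \<open>The automata built below have states of type \<open>bool\<close> or
  \<open>'q set option\<close>. An injection of the finite state set into \<open>nat\<close> carries
  them over to the state type of the theorem.\<close>

lemma dfa_states_nat:
  fixes M :: "('q, 'a) dfa"
  assumes wf: "wf_dfa M"
  shows "\<exists>M' :: (nat, 'a) dfa. wf_dfa M' \<and> alphabet M' = alphabet M \<and>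
    card (states M') = card (states M) \<and> language M' = language M"
proof -
  have "finite (states M)" using wf by (simp add: wf_dfa_def)
  then obtain f :: "'q \<Rightarrow> nat" where inj: "inj_on f (states M)"
    using finite_imp_inj_to_nat_seg by blast
  define M' where "M' = \<lparr>states = f ` states M, alphabet = alphabet M,
    trans = (\<lambda>k a. f (trans M (inv_into (states M) f k) a)), start = f (start M),
    finals = f ` finals M\<rparr>"
  have run: "foldl (trans M') (f q) w = f (foldl (trans M) q w)"
    if "q \<in> states M" "w \<in> lists (alphabet M)" for q w
    using that
  proof (induction w arbitrary: q)
    case (Cons a w)
    then show ?case using wf inj by (simp add: M'_def wf_dfa_def)
  qed simp
  have final: "f q \<in> f ` finals M \<longleftrightarrow> q \<in> finals M" if "q \<in> states M" for q
    using that inj wf by (meson inj_on_image_mem_iff wf_dfa_def)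
  have start: "start M \<in> states M" using wf by (simp add: wf_dfa_def)
  have "foldl (trans M') (start M') w \<in> finals M' \<longleftrightarrow> foldl (trans M) (start M) w \<in> finals M"
    if "w \<in> lists (alphabet M)" for w
    using run[OF start that] final[OF foldl_trans_in_states[OF wf start that]]
    by (simp add: M'_def)
  then have "language M' = language M"
    by (auto simp: language_def M'_def)
  moreover have "wf_dfa M'"
    using wf inj by (auto simp: M'_def wf_dfa_def)
  moreover have "card (states M') = card (states M)"
    using inj by (simp add: M'_def card_image)
  ultimately show ?thesis by (intro exI[of _ M']) (simp add: M'_def)
qed

text \<open>\<open>True\<close> means that nothing has been read yet, and \<open>False\<close> is a
  rejecting sink.\<close>

lemma ex_dfa_Nil:
  assumes "finite A" "A \<noteq> {}"
  shows "\<exists>M :: (bool, 'a) dfa. wf_dfa M \<and> alphabet M = A \<and> card (states M) = 2 \<and>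
    language M = {[]}"
proof -
  define M where "M = \<lparr>states = UNIV, alphabet = A, trans = (\<lambda>_ _. False), start = True,
    finals = {True}\<rparr>"
  have "foldl (\<lambda>_ _. False) True w \<longleftrightarrow> w = []" for w :: "'a list"
    by (cases w rule: rev_cases) auto
  then have "language M = {[]}" by (auto simp: M_def language_def)
  then show ?thesis using assms
    by (intro exI[of _ M]) (simp add: M_def wf_dfa_def card_UNIV_bool)
qed

section \<open>Subset construction for the star\<close>

definition accepted_from :: "('q, 'a) dfa \<Rightarrow> 'q set \<Rightarrow> 'a list set" where
  "accepted_from M I = {w \<in> lists (alphabet M). \<exists>i\<in>I. foldl (trans M) i w \<in> finals M}"

text \<open>Meeting \<open>finals M\<close> means that a factor may end here, so the next one may
  start at once from \<open>I\<close>.\<close>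

definition star_step :: "('q, 'a) dfa \<Rightarrow> 'q set \<Rightarrow> 'q set \<Rightarrow> 'a \<Rightarrow> 'q set" where
  "star_step M I S a = (let T = (\<lambda>q. trans M q a) ` S in
     if T \<inter> finals M = {} then T else T \<union> I)"

definition star_start :: "('q, 'a) dfa \<Rightarrow> 'q set \<Rightarrow> 'q set option" where
  "star_start M I = (if I \<inter> finals M = {} then None else Some I)"

definition star_sets :: "('q, 'a) dfa \<Rightarrow> 'q set \<Rightarrow> 'q set set" where
  "star_sets M I = {S. S \<subseteq> states M \<and> (S \<inter> finals M \<noteq> {} \<longrightarrow> I \<subseteq> S)}"

(* None is an accepting copy of the state I, without incoming transitions. *)
definition star_dfa :: "('q, 'a) dfa \<Rightarrow> 'q set \<Rightarrow> ('q set option, 'a) dfa" where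
  "star_dfa M I = \<lparr>states = insert (star_start M I) (Some ` star_sets M I),
     alphabet = alphabet M,
     trans = (\<lambda>X a. Some (star_step M I (case X of None \<Rightarrow> I | Some S \<Rightarrow> S) a)),
     start = star_start M I,
     finals = insert (star_start M I) (Some ` {S \<in> star_sets M I. S \<inter> finals M \<noteq> {}})\<rparr>"

text \<open>The intended meaning of the subset reached on \<open>w\<close>: \<open>u\<close> is
  already split into complete factors, and \<open>v\<close> is the part read of the factor in
  progress.\<close>

definition star_reach :: "('q, 'a) dfa \<Rightarrow> 'q set \<Rightarrow> 'a list \<Rightarrow> 'q set" where
  "star_reach M I w = {foldl (trans M) i v | i u v.
     i \<in> I \<and> w = u @ v \<and> u \<in> kleene_star (accepted_from M I)}"

lemma star_reach_Nil: "star_reach M I [] = I"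
  by (auto simp: star_reach_def Nil_in_kleene_star)

text \<open>The letter \<open>a\<close> completes the factor in progress, so membership can be
  tested on the successor set before \<open>I\<close> is added.\<close>

lemma snoc_in_kleene_star_iff:
  assumes "w @ [a] \<in> lists (alphabet M)"
  shows "w @ [a] \<in> kleene_star (accepted_from M I) \<longleftrightarrow>
    (\<lambda>q. trans M q a) ` star_reach M I w \<inter> finals M \<noteq> {}"
proof
  assume "w @ [a] \<in> kleene_star (accepted_from M I)"
  then obtain u v where *: "w = u @ v" "u \<in> kleene_star (accepted_from M I)"
    "v @ [a] \<in> accepted_from M I"
    by (rule kleene_star_snocE)
  then obtain i where "i \<in> I" "trans M (foldl (trans M) i v) a \<in> finals M"
    by (auto simp: accepted_from_def)
  moreover have "foldl (trans M) i v \<in> star_reach M I w"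
    using * \<open>i \<in> I\<close> unfolding star_reach_def by blast
  ultimately show "(\<lambda>q. trans M q a) ` star_reach M I w \<inter> finals M \<noteq> {}" by blast
next
  assume "(\<lambda>q. trans M q a) ` star_reach M I w \<inter> finals M \<noteq> {}"
  then obtain i u v where *: "i \<in> I" "w = u @ v" "u \<in> kleene_star (accepted_from M I)"
    "trans M (foldl (trans M) i v) a \<in> finals M"
    by (auto simp: star_reach_def)
  then have "v @ [a] \<in> accepted_from M I"
    using assms by (auto simp: accepted_from_def)
  from kleene_star_append[OF *(3) this] show "w @ [a] \<in> kleene_star (accepted_from M I)"
    using * by simp
qed

text \<open>In a splitting of \<open>w @ [a]\<close>, a nonempty factor in progress comes from
  \<open>star_reach M I w\<close> by reading \<open>a\<close>. An empty one contributes
  \<open>I\<close>, exactly when \<open>w @ [a]\<close> is in the star, which is the test made by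
  \<open>star_step\<close>.\<close>

lemma star_reach_snoc:
  assumes "w @ [a] \<in> lists (alphabet M)"
  shows "star_reach M I (w @ [a]) = star_step M I (star_reach M I w) a"
proof -
  have "star_reach M I (w @ [a]) = (\<lambda>q. trans M q a) ` star_reach M I w \<union>
    (if w @ [a] \<in> kleene_star (accepted_from M I) then I else {})" (is "?l = ?r")
  proof
    show "?l \<subseteq> ?r"
    proof
      fix q assume "q \<in> ?l"
      then obtain i u v where *: "i \<in> I" "w @ [a] = u @ v"
        "u \<in> kleene_star (accepted_from M I)" "q = foldl (trans M) i v"
        by (auto simp: star_reach_def)
      show "q \<in> ?r"
      proof (cases v rule: rev_cases)
        case Nil
        then show ?thesis using * by auto
      next
        case (snoc v' b)
        then have "foldl (trans M) i v' \<in> star_reach M I w"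
          using * unfolding star_reach_def by auto
        then show ?thesis using * snoc by auto
      qed
    qed
    have "trans M (foldl (trans M) i v) a \<in> star_reach M I ((u @ v) @ [a])"
      if "i \<in> I" "u \<in> kleene_star (accepted_from M I)" for i u v
      using that unfolding star_reach_def by (force intro: exI[of _ u] exI[of _ "v @ [a]"])
    moreover have "i \<in> ?l" if "i \<in> I" "w @ [a] \<in> kleene_star (accepted_from M I)" for i
      using that unfolding star_reach_def by force
    ultimately show "?r \<subseteq> ?l"
      by (auto simp: star_reach_def[of M I w])
  qed
  then show ?thesis
    by (simp add: star_step_def snoc_in_kleene_star_iff[OF assms] Let_def)
qed

section \<open>Correctness of the construction\<close>

lemma foldl_star_dfa:
  assumes "w \<in> lists (alphabet M)"
  shows "foldl (trans (star_dfa M I)) (star_start M I) w =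
    (if w = [] then star_start M I else Some (star_reach M I w))"
  using assms
proof (induction w rule: rev_induct)
  case (snoc a w)
  \<comment> \<open>The start state, be it \<open>None\<close> or \<open>Some I\<close>, acts as
    \<open>I\<close> on the first letter.\<close>
  have "trans (star_dfa M I) (star_start M I) a = Some (star_step M I I a)"
    by (simp add: star_dfa_def star_start_def)
  then show ?case
    using snoc star_reach_snoc[of w a M I] star_reach_Nil[of M I]
    by (auto simp: star_dfa_def)
qed simp

lemma star_step_in_star_sets:
  assumes "wf_dfa M" "I \<subseteq> states M" "S \<subseteq> states M" "a \<in> alphabet M"
  shows "star_step M I S a \<in> star_sets M I"
  using assms by (auto simp: star_step_def star_sets_def Let_def wf_dfa_def)

lemma star_reach_in_star_sets:
  assumes "wf_dfa M" "I \<subseteq> states M" "w \<in> lists (alphabet M)"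
  shows "star_reach M I w \<in> star_sets M I"
  using assms(3)
proof (induction w rule: rev_induct)
  case Nil
  then show ?case using assms by (simp add: star_reach_Nil star_sets_def)
next
  case (snoc a w)
  then show ?case
    using assms star_reach_snoc[of w a M I] star_step_in_star_sets[of M I]
    by (auto simp: star_sets_def)
qed

lemma wf_star_dfa:
  assumes "wf_dfa M" "I \<subseteq> states M"
  shows "wf_dfa (star_dfa M I)"
proof -
  have "star_sets M I \<subseteq> Pow (states M)" by (auto simp: star_sets_def)
  then have "finite (star_sets M I)"
    using assms(1) by (meson finite_Pow_iff finite_subset wf_dfa_def)
  moreover have "star_step M I (case X of None \<Rightarrow> I | Some S \<Rightarrow> S) a \<in> star_sets M I"
    if "X \<in> states (star_dfa M I)" "a \<in> alphabet M" for X a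
    using that assms
    by (intro star_step_in_star_sets)
      (auto simp: star_dfa_def star_sets_def star_start_def split: if_splits)
  ultimately show ?thesis
    using assms(1) by (auto simp: wf_dfa_def star_dfa_def)
qed

lemma language_star_dfa:
  assumes "wf_dfa M" "I \<subseteq> states M"
  shows "language (star_dfa M I) = kleene_star (accepted_from M I)"
proof -
  have "w \<in> language (star_dfa M I) \<longleftrightarrow> w \<in> kleene_star (accepted_from M I)"
    if w: "w \<in> lists (alphabet M)" for w
  proof (cases w rule: rev_cases)
    case Nil
    then show ?thesis
      by (simp add: language_def star_dfa_def Nil_in_kleene_star)
  next
    case (snoc v a)
    let ?T = "star_reach M I w"
    have T: "?T = star_step M I (star_reach M I v) a"
      using star_reach_snoc w snoc by metis
    have "foldl (trans (star_dfa M I)) (start (star_dfa M I)) w = Some ?T"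
      using foldl_star_dfa[OF w] snoc by (simp add: star_dfa_def)
    \<comment> \<open>Making the start state final adds nothing here: it equals
      \<open>Some ?T\<close> only if \<open>?T\<close> is \<open>I\<close> and \<open>I\<close>
      meets \<open>finals M\<close>.\<close>
    then have "w \<in> language (star_dfa M I) \<longleftrightarrow> ?T \<inter> finals M \<noteq> {}"
      using w star_reach_in_star_sets[OF assms w]
      by (auto simp: language_def star_dfa_def star_start_def)
    \<comment> \<open>\<open>star_step\<close> adds \<open>I\<close> only to a set that already
      meets \<open>finals M\<close>, so the test has the same outcome after the addition.\<close>
    also have "\<dots> \<longleftrightarrow> w \<in> kleene_star (accepted_from M I)"
      using snoc_in_kleene_star_iff[of v a M I] w snoc
      unfolding T star_step_def Let_def by auto
    finally show ?thesis .
  qed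
  moreover have "language (star_dfa M I) \<subseteq> lists (alphabet M)"
    by (auto simp: language_def star_dfa_def)
  moreover have "kleene_star (accepted_from M I) \<subseteq> lists (alphabet M)"
    by (rule kleene_star_subset_lists) (auto simp: accepted_from_def)
  ultimately show ?thesis by blast
qed

section \<open>Number of states, and application to the quotient\<close>

lemma card_star_dfa:
  assumes "wf_dfa M" "I \<subseteq> states M" "I \<noteq> {}" "finals M \<noteq> {}"
  shows "card (states (star_dfa M I)) \<le> 2 ^ card (states M)"
proof -
  have fin: "finite (Pow (states M))" using assms(1) by (simp add: wf_dfa_def)
  have sub: "star_sets M I \<subseteq> Pow (states M)" by (auto simp: star_sets_def)
  have card: "card (Some ` star_sets M I) = card (star_sets M I)"
    by (simp add: card_image)
  have "card (states (star_dfa M I)) \<le> card (Pow (states M))"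
  proof (cases "I \<inter> finals M = {}")
    case True
    obtain f where f: "f \<in> finals M" using assms(4) by blast
    \<comment> \<open>The invariant would give \<open>I \<subseteq> {f}\<close>, hence
      \<open>f \<in> I\<close> as \<open>I\<close> is nonempty. The place of \<open>{f}\<close> is
      thus free for \<open>None\<close>.\<close>
    then have "{f} \<notin> star_sets M I" using True assms(3) by (auto simp: star_sets_def)
    moreover have "{f} \<in> Pow (states M)" using f assms(1) by (auto simp: wf_dfa_def)
    ultimately have "card (star_sets M I) < card (Pow (states M))"
      using sub by (intro psubset_card_mono[OF fin]) blast
    then show ?thesis
      using card card_insert_le_m1[of "card (Pow (states M))" "Some ` star_sets M I" "star_start M I"]
      by (simp add: star_dfa_def)
  next
    case False
    \<comment> \<open>\<open>I\<close> itself satisfies the invariant, so the start state is not an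
      extra one.\<close>
    then have "states (star_dfa M I) = Some ` star_sets M I"
      using assms(2) by (auto simp: star_dfa_def star_start_def star_sets_def)
    then show ?thesis using card card_mono[OF fin sub] by simp
  qed
  then show ?thesis using assms(1) by (simp add: card_Pow wf_dfa_def)
qed

text \<open>A word of \<open>L\<close> matters only through the state it leads to, so even an
  arbitrary \<open>L\<close> enters just as a set of states.\<close>

lemma left_quotient_language:
  assumes "L \<subseteq> lists (alphabet M)"
  shows "left_quotient L (language M) = accepted_from M (foldl (trans M) (start M) ` L)"
  using assms by (fastforce simp: left_quotient_def language_def accepted_from_def)

theorem theorem1:
  fixes \<Sigma> :: "'a set" and n :: nat
    and M :: "('q, 'a) dfa" and L R :: "'a list set"
  assumes "finite \<Sigma>" and "card \<Sigma> \<ge> 2"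
    and "n > 0"
    and "wf_dfa M" and "alphabet M = \<Sigma>" and "card (states M) = n"
    and "R \<subseteq> lists \<Sigma>" and "language M = R"
    and "L \<subseteq> lists \<Sigma>"
  shows "\<exists>M' :: (nat, 'a) dfa.
           wf_dfa M' \<and> alphabet M' = \<Sigma> \<and> card (states M') \<le> 2 ^ n \<and>
           language M' = kleene_star (left_quotient L R)"
proof -
  define I where "I = foldl (trans M) (start M) ` L"
  have IQ: "I \<subseteq> states M"
  proof -
    have "start M \<in> states M" using assms(4) by (simp add: wf_dfa_def)
    then show ?thesis
      using foldl_trans_in_states[OF assms(4)] assms(5,9) unfolding I_def by blast
  qed
  have K: "left_quotient L R = accepted_from M I"
    using assms left_quotient_language[of L M] by (simp add: I_def)
  show ?thesis
  proof (cases "I = {} \<or> finals M = {}")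
    case True
    \<comment> \<open>In both degenerate cases the quotient is empty.\<close>
    then have "kleene_star (left_quotient L R) = {[]}"
      by (auto simp: K accepted_from_def kleene_star_empty)
    moreover obtain N :: "(bool, 'a) dfa" where "wf_dfa N" "alphabet N = \<Sigma>"
      "card (states N) = 2" "language N = {[]}"
      using ex_dfa_Nil[of \<Sigma>] assms(1,2) by fastforce
    \<comment> \<open>Positivity of \<open>n\<close> makes room for the two states.\<close>
    moreover have "(2::nat) \<le> 2 ^ n" using assms(3) by (simp add: self_le_power)
    ultimately show ?thesis using dfa_states_nat[of N] by force
  next
    case False
    have "alphabet (star_dfa M I) = \<Sigma>" using assms(5) by (simp add: star_dfa_def)
    then show ?thesis
      using dfa_states_nat[OF wf_star_dfa[OF assms(4) IQ]] card_star_dfa[OF assms(4) IQ] False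
        language_star_dfa[OF assms(4) IQ] assms(6) K
      by metis
  qed
qed

end
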